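(* Let $L$ be either of the sequent calculi $\mathrm{lTS4}$ or $\mathrm{gTS4}$ defined in the context. Then the rules ($\neg$left) $\Gamma\Rightarrow\Delta,\alpha$ / $\neg\alpha,\Gamma\Rightarrow\Delta$ and ($\neg$right) $\alpha,\Gamma\Rightarrow\Delta$ / $\Gamma\Rightarrow\Delta,\neg\alpha$ are admissible in cut-free $L$.
   Context: Formulas are built from countably many propositional variables using the binary connectives $\wedge,\vee,\to$ and the unary connectives $\neg,\Box,\Diamond$. Letters $\Gamma,\Delta$ (possibly with subscripts) denote finite, possibly empty, sets of formulas; a sequent is an expression $\Gamma\Rightarrow\Delta$; a comma denotes union. For a word $w$ over $\{\neg,\Box,\Diamond\}$, $w\Gamma=\{w\gamma:\gamma\in\Gamma\}$. A rule "$S_1;\dots;S_n\,/\,S$" has premises $S_1,\dots,S_n$ and conclusion $S$. "Cut-free $L$" means the system $L$ with the rule (cut) removed. A rule $R$ is admissible in a calculus $M$ if for every instance of $R$ with premises $S_1,\dots,S_n$ and conclusion $S$, whenever every $S_i$ is provable in $M$, $S$ is provable in $M$. The calculus lTS4. Initial sequents: for every propositional variable $p$: $p\Rightarrow p$, $\neg p\Rightarrow\neg p$, $\neg p,p\Rightarrow$, and $\Rightarrow\neg p,p$. Structural rules: (cut) $\Gamma\Rightarrow\alpha$; $\alpha,\Gamma\Rightarrow\Delta$ / $\Gamma\Rightarrow\Delta$. (we-left) $\Gamma\Rightarrow\Delta$ / $\alpha,\Gamma\Rightarrow\Delta$. (we-right) $\Gamma\Rightarrow\Delta$ / $\Gamma\Rightarrow\Delta,\alpha$.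 Non-twist logical rules: ($\wedge$left) $\alpha,\beta,\Gamma\Rightarrow\Delta$ / $\alpha\wedge\beta,\Gamma\Rightarrow\Delta$. ($\wedge$right) $\Gamma\Rightarrow\Delta,\alpha$; $\Gamma\Rightarrow\Delta,\beta$ / $\Gamma\Rightarrow\Delta,\alpha\wedge\beta$. ($\vee$left) $\alpha,\Gamma\Rightarrow\Delta$; $\beta,\Gamma\Rightarrow\Delta$ / $\alpha\vee\beta,\Gamma\Rightarrow\Delta$. ($\vee$right) $\Gamma\Rightarrow\Delta,\alpha,\beta$ / $\Gamma\Rightarrow\Delta,\alpha\vee\beta$. ($\to$left) $\Gamma\Rightarrow\Delta,\alpha$; $\beta,\Gamma\Rightarrow\Delta$ / $\alpha\to\beta,\Gamma\Rightarrow\Delta$. ($\to$right) $\alpha,\Gamma\Rightarrow\Delta,\beta$ / $\Gamma\Rightarrow\Delta,\alpha\to\beta$. ($\Box$left) $\alpha,\Gamma\Rightarrow\Delta$ / $\Box\alpha,\Gamma\Rightarrow\Delta$. ($\Box$right) $\Box\Gamma_1,\neg\Diamond\Gamma_2\Rightarrow\Diamond\Delta_1,\neg\Box\Delta_2,\alpha$ / $\Box\Gamma_1,\neg\Diamond\Gamma_2\Rightarrow\Diamond\Delta_1,\neg\Box\Delta_2,\Box\alpha$. ($\Diamond$left) $\alpha,\Box\Gamma_1,\neg\Diamond\Gamma_2\Rightarrow\Diamond\Delta_1,\neg\Box\Delta_2$ / $\Diamond\alpha,\Box\Gamma_1,\neg\Diamond\Gamma_2\Rightarrow\Diamond\Delta_1,\neg\Box\Delta_2$.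 ($\Diamond$right) $\Gamma\Rightarrow\Delta,\alpha$ / $\Gamma\Rightarrow\Delta,\Diamond\alpha$. Twist rules: ($\neg\neg$left$^t$) $\alpha,\Gamma\Rightarrow\Delta$ / $\neg\neg\alpha,\Gamma\Rightarrow\Delta$. ($\neg\neg$right$^t$) $\Gamma\Rightarrow\Delta,\alpha$ / $\Gamma\Rightarrow\Delta,\neg\neg\alpha$. ($\neg\wedge$left$^t$) $\Gamma\Rightarrow\Delta,\alpha$; $\Gamma\Rightarrow\Delta,\beta$ / $\neg(\alpha\wedge\beta),\Gamma\Rightarrow\Delta$. ($\neg\wedge$right$^t$) $\alpha,\beta,\Gamma\Rightarrow\Delta$ / $\Gamma\Rightarrow\Delta,\neg(\alpha\wedge\beta)$. ($\neg\vee$left$^t$) $\Gamma\Rightarrow\Delta,\alpha,\beta$ / $\neg(\alpha\vee\beta),\Gamma\Rightarrow\Delta$. ($\neg\vee$right$^t$) $\alpha,\Gamma\Rightarrow\Delta$; $\beta,\Gamma\Rightarrow\Delta$ / $\Gamma\Rightarrow\Delta,\neg(\alpha\vee\beta)$. ($\neg\to$left$^t$) $\alpha,\Gamma\Rightarrow\Delta,\beta$ / $\neg(\alpha\to\beta),\Gamma\Rightarrow\Delta$. ($\neg\to$right$^t$) $\Gamma\Rightarrow\Delta,\alpha$; $\beta,\Gamma\Rightarrow\Delta$ / $\Gamma\Rightarrow\Delta,\neg(\alpha\to\beta)$. ($\neg\Box$left$^t$) $\Box\Gamma_1,\neg\Diamond\Gamma_2\Rightarrow\Diamond\Delta_1,\neg\Box\Delta_2,\alpha$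 / $\neg\Box\alpha,\Box\Gamma_1,\neg\Diamond\Gamma_2\Rightarrow\Diamond\Delta_1,\neg\Box\Delta_2$. ($\neg\Box$right$^t$) $\alpha,\Gamma\Rightarrow\Delta$ / $\Gamma\Rightarrow\Delta,\neg\Box\alpha$. ($\neg\Diamond$left$^t$) $\Gamma\Rightarrow\Delta,\alpha$ / $\neg\Diamond\alpha,\Gamma\Rightarrow\Delta$. ($\neg\Diamond$right$^t$) $\alpha,\Box\Gamma_1,\neg\Diamond\Gamma_2\Rightarrow\Diamond\Delta_1,\neg\Box\Delta_2$ / $\Box\Gamma_1,\neg\Diamond\Gamma_2\Rightarrow\Diamond\Delta_1,\neg\Box\Delta_2,\neg\Diamond\alpha$. (lTS4 has no rules ($\neg$left), ($\neg$right).) The calculus gTS4 is obtained from lTS4 by replacing ($\Box$right), ($\Diamond$left), ($\neg\Box$left$^t$), ($\neg\Diamond$right$^t$) with: ($\Box$right$^T$) $\Box\Gamma_1,\Box\Delta_2\Rightarrow\Diamond\Delta_1,\Diamond\Gamma_2,\alpha$ / $\Box\Gamma_1,\neg\Diamond\Gamma_2\Rightarrow\Diamond\Delta_1,\neg\Box\Delta_2,\Box\alpha$. ($\Diamond$left$^T$) $\alpha,\Box\Gamma_1,\Box\Delta_2\Rightarrow\Diamond\Delta_1,\Diamond\Gamma_2$ / $\Diamond\alpha,\Box\Gamma_1,\neg\Diamond\Gamma_2\Rightarrow\Diamond\Delta_1,\neg\Box\Delta_2$. ($\neg\Box$left$^T$) $\Box\Gamma_1,\Box\Delta_2\Rightarrow\Diamond\Delta_1,\Diamond\Gamma_2,\alpha$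 / $\neg\Box\alpha,\Box\Gamma_1,\neg\Diamond\Gamma_2\Rightarrow\Diamond\Delta_1,\neg\Box\Delta_2$. ($\neg\Diamond$right$^T$) $\alpha,\Box\Gamma_1,\Box\Delta_2\Rightarrow\Diamond\Delta_1,\Diamond\Gamma_2$ / $\Box\Gamma_1,\neg\Diamond\Gamma_2\Rightarrow\Diamond\Delta_1,\neg\Box\Delta_2,\neg\Diamond\alpha$. (All other rules and initial sequents of lTS4, including ($\neg\Diamond$left$^t$), are kept.) *)

theory Defs
  imports Main "HOL-Library.FSet"
begin

datatype fm =
    Var nat
  | Con fm fm (infixr "\<^bold>\<and>" 60)
  | Dis fm fm (infixr "\<^bold>\<or>" 55)
  | Imp fm fm (infixr "\<^bold>\<rightarrow>" 50)
  | Neg fm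
  | Box fm
  | Dia fm

datatype sequent = Sequent "fm fset" "fm fset" (infix "\<Rrightarrow>" 45)

abbreviation Boxes :: "fm fset \<Rightarrow> fm fset" where
  "Boxes \<Gamma> \<equiv> Box |`| \<Gamma>"

abbreviation Dias :: "fm fset \<Rightarrow> fm fset" where
  "Dias \<Gamma> \<equiv> Dia |`| \<Gamma>"

abbreviation NegBoxes :: "fm fset \<Rightarrow> fm fset" where
  "NegBoxes \<Gamma> \<equiv> (\<lambda>\<gamma>. Neg (Box \<gamma>)) |`| \<Gamma>"

abbreviation NegDias :: "fm fset \<Rightarrow> fm fset" where
  "NegDias \<Gamma> \<equiv> (\<lambda>\<gamma>. Neg (Dia \<gamma>)) |`| \<Gamma>"

text \<open>
  Rules are identified by name rather than by their set of instances, so that removing a rule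
  from a calculus never removes an instance it happens to share with another rule.
\<close>

datatype rule =
    InitPos | InitNeg | InitLeft | InitRight
  | Cut | WeLeft | WeRight | AndLeft
  | AndRight | OrLeft | OrRight | ImpLeft
  | ImpRight | BoxLeft | BoxRight | DiaLeft
  | DiaRight | NegNegLeft | NegNegRight | NegAndLeft
  | NegAndRight | NegOrLeft | NegOrRight | NegImpLeft
  | NegImpRight | NegBoxLeft | NegBoxRight | NegDiaLeft
  | NegDiaRight | BoxRightT | DiaLeftT | NegBoxLeftT
  | NegDiaRightT | NegLeft | NegRight

text \<open>
  \<open>rule_instance r Ss S\<close>: the list of premises \<open>Ss\<close> and the conclusion \<open>S\<close> form an
  instance of the rule named \<open>r\<close>; initial sequents are rules without premises.
\<close>

inductive rule_instance :: "rule \<Rightarrow> sequent list \<Rightarrow> sequent \<Rightarrow> bool" where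
  "rule_instance InitPos
     []
     ({|Var p|} \<Rrightarrow> {|Var p|})"
| "rule_instance InitNeg
     []
     ({|Neg (Var p)|} \<Rrightarrow> {|Neg (Var p)|})"
| "rule_instance InitLeft
     []
     ({|Neg (Var p), Var p|} \<Rrightarrow> {||})"
| "rule_instance InitRight
     []
     ({||} \<Rrightarrow> {|Neg (Var p), Var p|})"
| "rule_instance Cut
     [\<Gamma> \<Rrightarrow> {|\<alpha>|},
      finsert \<alpha> \<Gamma> \<Rrightarrow> \<Delta>]
     (\<Gamma> \<Rrightarrow> \<Delta>)"
| "rule_instance WeLeft
     [\<Gamma> \<Rrightarrow> \<Delta>]
     (finsert \<alpha> \<Gamma> \<Rrightarrow> \<Delta>)"
| "rule_instance WeRight
     [\<Gamma> \<Rrightarrow> \<Delta>]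
     (\<Gamma> \<Rrightarrow> finsert \<alpha> \<Delta>)"
| "rule_instance AndLeft
     [finsert \<alpha> (finsert \<beta> \<Gamma>) \<Rrightarrow> \<Delta>]
     (finsert (\<alpha> \<^bold>\<and> \<beta>) \<Gamma> \<Rrightarrow> \<Delta>)"
| "rule_instance AndRight
     [\<Gamma> \<Rrightarrow> finsert \<alpha> \<Delta>,
      \<Gamma> \<Rrightarrow> finsert \<beta> \<Delta>]
     (\<Gamma> \<Rrightarrow> finsert (\<alpha> \<^bold>\<and> \<beta>) \<Delta>)"
| "rule_instance OrLeft
     [finsert \<alpha> \<Gamma> \<Rrightarrow> \<Delta>,
      finsert \<beta> \<Gamma> \<Rrightarrow> \<Delta>]
     (finsert (\<alpha> \<^bold>\<or> \<beta>) \<Gamma> \<Rrightarrow> \<Delta>)"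
| "rule_instance OrRight
     [\<Gamma> \<Rrightarrow> finsert \<alpha> (finsert \<beta> \<Delta>)]
     (\<Gamma> \<Rrightarrow> finsert (\<alpha> \<^bold>\<or> \<beta>) \<Delta>)"
| "rule_instance ImpLeft
     [\<Gamma> \<Rrightarrow> finsert \<alpha> \<Delta>,
      finsert \<beta> \<Gamma> \<Rrightarrow> \<Delta>]
     (finsert (\<alpha> \<^bold>\<rightarrow> \<beta>) \<Gamma> \<Rrightarrow> \<Delta>)"
| "rule_instance ImpRight
     [finsert \<alpha> \<Gamma> \<Rrightarrow> finsert \<beta> \<Delta>]
     (\<Gamma> \<Rrightarrow> finsert (\<alpha> \<^bold>\<rightarrow> \<beta>) \<Delta>)"
| "rule_instance BoxLeft
     [finsert \<alpha> \<Gamma> \<Rrightarrow> \<Delta>]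
     (finsert (Box \<alpha>) \<Gamma> \<Rrightarrow> \<Delta>)"
| "rule_instance BoxRight
     [Boxes \<Gamma>\<^sub>1 |\<union>| NegDias \<Gamma>\<^sub>2 \<Rrightarrow> finsert \<alpha> (Dias \<Delta>\<^sub>1 |\<union>| NegBoxes \<Delta>\<^sub>2)]
     (Boxes \<Gamma>\<^sub>1 |\<union>| NegDias \<Gamma>\<^sub>2 \<Rrightarrow> finsert (Box \<alpha>) (Dias \<Delta>\<^sub>1 |\<union>| NegBoxes \<Delta>\<^sub>2))"
| "rule_instance DiaLeft
     [finsert \<alpha> (Boxes \<Gamma>\<^sub>1 |\<union>| NegDias \<Gamma>\<^sub>2) \<Rrightarrow> Dias \<Delta>\<^sub>1 |\<union>| NegBoxes \<Delta>\<^sub>2]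
     (finsert (Dia \<alpha>) (Boxes \<Gamma>\<^sub>1 |\<union>| NegDias \<Gamma>\<^sub>2) \<Rrightarrow> Dias \<Delta>\<^sub>1 |\<union>| NegBoxes \<Delta>\<^sub>2)"
| "rule_instance DiaRight
     [\<Gamma> \<Rrightarrow> finsert \<alpha> \<Delta>]
     (\<Gamma> \<Rrightarrow> finsert (Dia \<alpha>) \<Delta>)"
| "rule_instance NegNegLeft
     [finsert \<alpha> \<Gamma> \<Rrightarrow> \<Delta>]
     (finsert (Neg (Neg \<alpha>)) \<Gamma> \<Rrightarrow> \<Delta>)"
| "rule_instance NegNegRight
     [\<Gamma> \<Rrightarrow> finsert \<alpha> \<Delta>]
     (\<Gamma> \<Rrightarrow> finsert (Neg (Neg \<alpha>)) \<Delta>)"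
| "rule_instance NegAndLeft
     [\<Gamma> \<Rrightarrow> finsert \<alpha> \<Delta>,
      \<Gamma> \<Rrightarrow> finsert \<beta> \<Delta>]
     (finsert (Neg (\<alpha> \<^bold>\<and> \<beta>)) \<Gamma> \<Rrightarrow> \<Delta>)"
| "rule_instance NegAndRight
     [finsert \<alpha> (finsert \<beta> \<Gamma>) \<Rrightarrow> \<Delta>]
     (\<Gamma> \<Rrightarrow> finsert (Neg (\<alpha> \<^bold>\<and> \<beta>)) \<Delta>)"
| "rule_instance NegOrLeft
     [\<Gamma> \<Rrightarrow> finsert \<alpha> (finsert \<beta> \<Delta>)]
     (finsert (Neg (\<alpha> \<^bold>\<or> \<beta>)) \<Gamma> \<Rrightarrow> \<Delta>)"
| "rule_instance NegOrRight
     [finsert \<alpha> \<Gamma> \<Rrightarrow> \<Delta>,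
      finsert \<beta> \<Gamma> \<Rrightarrow> \<Delta>]
     (\<Gamma> \<Rrightarrow> finsert (Neg (\<alpha> \<^bold>\<or> \<beta>)) \<Delta>)"
| "rule_instance NegImpLeft
     [finsert \<alpha> \<Gamma> \<Rrightarrow> finsert \<beta> \<Delta>]
     (finsert (Neg (\<alpha> \<^bold>\<rightarrow> \<beta>)) \<Gamma> \<Rrightarrow> \<Delta>)"
| "rule_instance NegImpRight
     [\<Gamma> \<Rrightarrow> finsert \<alpha> \<Delta>,
      finsert \<beta> \<Gamma> \<Rrightarrow> \<Delta>]
     (\<Gamma> \<Rrightarrow> finsert (Neg (\<alpha> \<^bold>\<rightarrow> \<beta>)) \<Delta>)"
| "rule_instance NegBoxLeft
     [Boxes \<Gamma>\<^sub>1 |\<union>| NegDias \<Gamma>\<^sub>2 \<Rrightarrow> finsert \<alpha> (Dias \<Delta>\<^sub>1 |\<union>| NegBoxes \<Delta>\<^sub>2)]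
     (finsert (Neg (Box \<alpha>)) (Boxes \<Gamma>\<^sub>1 |\<union>| NegDias \<Gamma>\<^sub>2) \<Rrightarrow> Dias \<Delta>\<^sub>1 |\<union>| NegBoxes \<Delta>\<^sub>2)"
| "rule_instance NegBoxRight
     [finsert \<alpha> \<Gamma> \<Rrightarrow> \<Delta>]
     (\<Gamma> \<Rrightarrow> finsert (Neg (Box \<alpha>)) \<Delta>)"
| "rule_instance NegDiaLeft
     [\<Gamma> \<Rrightarrow> finsert \<alpha> \<Delta>]
     (finsert (Neg (Dia \<alpha>)) \<Gamma> \<Rrightarrow> \<Delta>)"
| "rule_instance NegDiaRight
     [finsert \<alpha> (Boxes \<Gamma>\<^sub>1 |\<union>| NegDias \<Gamma>\<^sub>2) \<Rrightarrow> Dias \<Delta>\<^sub>1 |\<union>| NegBoxes \<Delta>\<^sub>2]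
     (Boxes \<Gamma>\<^sub>1 |\<union>| NegDias \<Gamma>\<^sub>2 \<Rrightarrow> finsert (Neg (Dia \<alpha>)) (Dias \<Delta>\<^sub>1 |\<union>| NegBoxes \<Delta>\<^sub>2))"
| "rule_instance BoxRightT
     [Boxes \<Gamma>\<^sub>1 |\<union>| Boxes \<Delta>\<^sub>2 \<Rrightarrow> finsert \<alpha> (Dias \<Delta>\<^sub>1 |\<union>| Dias \<Gamma>\<^sub>2)]
     (Boxes \<Gamma>\<^sub>1 |\<union>| NegDias \<Gamma>\<^sub>2 \<Rrightarrow> finsert (Box \<alpha>) (Dias \<Delta>\<^sub>1 |\<union>| NegBoxes \<Delta>\<^sub>2))"
| "rule_instance DiaLeftT
     [finsert \<alpha> (Boxes \<Gamma>\<^sub>1 |\<union>| Boxes \<Delta>\<^sub>2) \<Rrightarrow> Dias \<Delta>\<^sub>1 |\<union>| Dias \<Gamma>\<^sub>2]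
     (finsert (Dia \<alpha>) (Boxes \<Gamma>\<^sub>1 |\<union>| NegDias \<Gamma>\<^sub>2) \<Rrightarrow> Dias \<Delta>\<^sub>1 |\<union>| NegBoxes \<Delta>\<^sub>2)"
| "rule_instance NegBoxLeftT
     [Boxes \<Gamma>\<^sub>1 |\<union>| Boxes \<Delta>\<^sub>2 \<Rrightarrow> finsert \<alpha> (Dias \<Delta>\<^sub>1 |\<union>| Dias \<Gamma>\<^sub>2)]
     (finsert (Neg (Box \<alpha>)) (Boxes \<Gamma>\<^sub>1 |\<union>| NegDias \<Gamma>\<^sub>2) \<Rrightarrow> Dias \<Delta>\<^sub>1 |\<union>| NegBoxes \<Delta>\<^sub>2)"
| "rule_instance NegDiaRightT
     [finsert \<alpha> (Boxes \<Gamma>\<^sub>1 |\<union>| Boxes \<Delta>\<^sub>2) \<Rrightarrow> Dias \<Delta>\<^sub>1 |\<union>| Dias \<Gamma>\<^sub>2]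
     (Boxes \<Gamma>\<^sub>1 |\<union>| NegDias \<Gamma>\<^sub>2 \<Rrightarrow> finsert (Neg (Dia \<alpha>)) (Dias \<Delta>\<^sub>1 |\<union>| NegBoxes \<Delta>\<^sub>2))"
| "rule_instance NegLeft
     [\<Gamma> \<Rrightarrow> finsert \<alpha> \<Delta>]
     (finsert (Neg \<alpha>) \<Gamma> \<Rrightarrow> \<Delta>)"
| "rule_instance NegRight
     [finsert \<alpha> \<Gamma> \<Rrightarrow> \<Delta>]
     (\<Gamma> \<Rrightarrow> finsert (Neg \<alpha>) \<Delta>)"

inductive provable :: "rule set \<Rightarrow> sequent \<Rightarrow> bool" for M where
  "\<lbrakk>r \<in> M; rule_instance r Ss S; \<forall>S' \<in> set Ss. provable M S'\<rbrakk> \<Longrightarrow> provable M S"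

definition admissible :: "rule \<Rightarrow> rule set \<Rightarrow> bool" where
  "admissible r M \<longleftrightarrow>
     (\<forall>Ss S. rule_instance r Ss S \<longrightarrow> (\<forall>S' \<in> set Ss. provable M S') \<longrightarrow> provable M S)"

definition cut_free :: "rule set \<Rightarrow> rule set" where
  "cut_free L = L - {Cut}"

definition lTS4 :: "rule set" where
  "lTS4 =
    {InitPos, InitNeg, InitLeft, InitRight,
     Cut, WeLeft, WeRight, AndLeft,
     AndRight, OrLeft, OrRight, ImpLeft,
     ImpRight, BoxLeft, BoxRight, DiaLeft,
     DiaRight, NegNegLeft, NegNegRight, NegAndLeft,
     NegAndRight, NegOrLeft, NegOrRight, NegImpLeft,
     NegImpRight, NegBoxLeft, NegBoxRight, NegDiaLeft,
     NegDiaRight}"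

definition gTS4 :: "rule set" where
  "gTS4 =
    (lTS4 - {BoxRight, DiaLeft, NegBoxLeft, NegDiaRight}) \<union>
    {BoxRightT, DiaLeftT, NegBoxLeftT, NegDiaRightT}"

end

theory Submission imports Defs begin

text \<open>
  Both negation rules move a formula across the arrow while adding a negation. A direct induction
  on the derivation breaks down for two reasons: sides are sets, so the principal formula may
  survive in a premise, and negated modal contexts such as \<open>\<not>\<box>\<Delta>\<close> force one to remove negations
  as well. Both problems disappear if any number of formulas may cross the arrow at the same time,
  each either gaining or losing a negation: provability in the cut-free calculus is invariant
  under this relation, since every rule has a twin for the crossed principal formula, and modal
  contexts stay modal contexts when \<open>\<box>\<gamma>\<close> on the left is exchanged with \<open>\<not>\<box>\<gamma>\<close> on the right
  and \<open>\<diamond>\<gamma>\<close> on the right with \<open>\<not>\<diamond>\<gamma>\<close> on the left.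
\<close>

text \<open>
  \<open>occ \<phi> X Y\<close>: the formula \<open>\<phi>\<close>, meant for the side \<open>X\<close>, is found there or, with one negation
  added or removed, on the opposite side \<open>Y\<close>.
\<close>

definition occ :: "fm \<Rightarrow> fm fset \<Rightarrow> fm fset \<Rightarrow> bool" where
  "occ \<phi> X Y \<longleftrightarrow> \<phi> |\<in>| X \<or> Neg \<phi> |\<in>| Y \<or> (\<exists>\<psi>. \<phi> = Neg \<psi> \<and> \<psi> |\<in>| Y)"

text \<open>Only the formulas of the first sequent are constrained. The second may contain further
  ones, so weakening is built into the relation, and several formulas may share one image.\<close>

fun crosses :: "sequent \<Rightarrow> sequent \<Rightarrow> bool" where
  "crosses (\<Gamma> \<Rrightarrow> \<Delta>) (\<Gamma>' \<Rrightarrow> \<Delta>') \<longleftrightarrow>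
     (\<forall>\<gamma>. \<gamma> |\<in>| \<Gamma> \<longrightarrow> occ \<gamma> \<Gamma>' \<Delta>') \<and> (\<forall>\<delta>. \<delta> |\<in>| \<Delta> \<longrightarrow> occ \<delta> \<Delta>' \<Gamma>')"

text \<open>What the two cut-free calculi share: all that is missing are the four modal rules whose
  context is restricted. This lets most of the argument be done once.\<close>

definition common :: "rule set" where
  "common =
    {InitPos, InitNeg, InitLeft, InitRight,
     WeLeft, WeRight, AndLeft,
     AndRight, OrLeft, OrRight, ImpLeft,
     ImpRight, BoxLeft,
     DiaRight, NegNegLeft, NegNegRight, NegAndLeft,
     NegAndRight, NegOrLeft, NegOrRight, NegImpLeft,
     NegImpRight, NegBoxRight, NegDiaLeft}"

lemma cut_free_lTS4: "cut_free lTS4 = common \<union> {BoxRight, DiaLeft, NegBoxLeft, NegDiaRight}"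
  by (auto simp: cut_free_def lTS4_def common_def)

lemma cut_free_gTS4: "cut_free gTS4 = common \<union> {BoxRightT, DiaLeftT, NegBoxLeftT, NegDiaRightT}"
  by (auto simp: cut_free_def gTS4_def lTS4_def common_def)

section \<open>Monotonicity of the crossing relation\<close>

lemma occ_member [simp]: "\<phi> |\<in>| X \<Longrightarrow> occ \<phi> X Y"
  by (simp add: occ_def)

lemma occ_mono: "occ \<phi> X Y \<Longrightarrow> X |\<subseteq>| X' \<Longrightarrow> Y |\<subseteq>| Y' \<Longrightarrow> occ \<phi> X' Y'"
  by (auto simp: occ_def)

lemma crosses_mono:
  "crosses S (\<Gamma> \<Rrightarrow> \<Delta>) \<Longrightarrow> \<Gamma> |\<subseteq>| \<Gamma>' \<Longrightarrow> \<Delta> |\<subseteq>| \<Delta>' \<Longrightarrow> crosses S (\<Gamma>' \<Rrightarrow> \<Delta>')"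
  by (cases S) (auto intro: occ_mono)

lemma crosses_finsert_left [simp]:
  "crosses (finsert \<alpha> \<Gamma> \<Rrightarrow> \<Delta>) (\<Gamma>' \<Rrightarrow> \<Delta>') \<longleftrightarrow>
     occ \<alpha> \<Gamma>' \<Delta>' \<and> crosses (\<Gamma> \<Rrightarrow> \<Delta>) (\<Gamma>' \<Rrightarrow> \<Delta>')"
  by auto

lemma crosses_finsert_right [simp]:
  "crosses (\<Gamma> \<Rrightarrow> finsert \<alpha> \<Delta>) (\<Gamma>' \<Rrightarrow> \<Delta>') \<longleftrightarrow>
     occ \<alpha> \<Delta>' \<Gamma>' \<and> crosses (\<Gamma> \<Rrightarrow> \<Delta>) (\<Gamma>' \<Rrightarrow> \<Delta>')"
  by auto

text \<open>With \<open>crosses\<close> kept folded, the two rules above peel off single formulas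
  while the remaining context stays one fact, ready for \<open>crosses_mono\<close>.\<close>

lemmas [simp del] = crosses.simps

lemma provable1:
  "rule_instance r [S] T \<Longrightarrow> r \<in> M \<Longrightarrow> provable M S \<Longrightarrow> provable M T"
  by (rule provable.intros) auto

lemma provable2:
  "rule_instance r [S, S'] T \<Longrightarrow> r \<in> M \<Longrightarrow> provable M S \<Longrightarrow> provable M S' \<Longrightarrow> provable M T"
  by (rule provable.intros) auto

lemma provable0: "rule_instance r [] T \<Longrightarrow> r \<in> M \<Longrightarrow> provable M T"
  by (rule provable.intros) auto

section \<open>Weakening and double negation in any calculus containing the common rules\<close>

context
  fixes M :: "rule set"
  assumes common: "common \<subseteq> M"
begin

lemma provable_union:
  assumes "provable M (\<Gamma> \<Rrightarrow> \<Delta>)"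
  shows "provable M (\<Gamma>' |\<union>| \<Gamma> \<Rrightarrow> \<Delta>' |\<union>| \<Delta>)"
proof -
  have "provable M (\<Gamma>' |\<union>| \<Gamma> \<Rrightarrow> \<Delta>)"
  proof (induction \<Gamma>')
    case (insert x \<Gamma>')
    then show ?case
      using provable1[OF rule_instance.intros(6)] common by (simp add: common_def)
  qed (use assms in simp)
  then show ?thesis
  proof (induction \<Delta>')
    case (insert x \<Delta>')
    then show ?case
      using provable1[OF rule_instance.intros(7)] common by (simp add: common_def)
  qed simp
qed

lemma provable_weaken:
  "provable M (\<Gamma> \<Rrightarrow> \<Delta>) \<Longrightarrow> \<Gamma> |\<subseteq>| \<Gamma>' \<Longrightarrow> \<Delta> |\<subseteq>| \<Delta>' \<Longrightarrow> provable M (\<Gamma>' \<Rrightarrow> \<Delta>')"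
  using provable_union[of \<Gamma> \<Delta> \<Gamma>' \<Delta>'] by (simp add: sup_absorb1)

text \<open>Sides are sets, so the principal formula of a rule may already lie in its context. The
  rule then simply erases its active formula; the crossing lemmas for the connectives use their
  rules in this form too.\<close>

lemma NegNeg_left:
  "provable M (finsert \<alpha> \<Gamma> \<Rrightarrow> \<Delta>) \<Longrightarrow> Neg (Neg \<alpha>) |\<in>| \<Gamma> \<Longrightarrow> provable M (\<Gamma> \<Rrightarrow> \<Delta>)"
  using provable1[OF rule_instance.intros(18)[of \<alpha> \<Gamma> \<Delta>]] common
  by (auto simp: common_def finsert_absorb)

lemma NegNeg_right:
  "provable M (\<Gamma> \<Rrightarrow> finsert \<alpha> \<Delta>) \<Longrightarrow> Neg (Neg \<alpha>) |\<in>| \<Delta> \<Longrightarrow> provable M (\<Gamma> \<Rrightarrow> \<Delta>)"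
  using provable1[OF rule_instance.intros(19)[of \<Gamma> \<alpha> \<Delta>]] common
  by (auto simp: common_def finsert_absorb)

text \<open>First weaken by the whole target sequent, then remove the source formulas one at a time:
  each is either absorbed by the target or erased by a double negation rule.\<close>

lemma provable_weaken_NegNeg:
  assumes "provable M (\<Gamma> \<Rrightarrow> \<Delta>)"
    and left: "\<And>\<gamma>. \<gamma> |\<in>| \<Gamma> \<Longrightarrow> \<gamma> |\<in>| \<Gamma>' \<or> Neg (Neg \<gamma>) |\<in>| \<Gamma>'"
    and right: "\<And>\<delta>. \<delta> |\<in>| \<Delta> \<Longrightarrow> \<delta> |\<in>| \<Delta>' \<or> Neg (Neg \<delta>) |\<in>| \<Delta>'"
  shows "provable M (\<Gamma>' \<Rrightarrow> \<Delta>')"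
proof -
  have "provable M (\<Gamma> |\<union>| \<Gamma>' \<Rrightarrow> \<Delta> |\<union>| \<Delta>')"
    using provable_union[OF assms(1), of \<Gamma>' \<Delta>'] by (simp add: sup_commute)
  then have "provable M (\<Gamma>' \<Rrightarrow> \<Delta> |\<union>| \<Delta>')"
    using left
  proof (induction \<Gamma>)
    case (insert x \<Gamma>)
    have "provable M (\<Gamma> |\<union>| \<Gamma>' \<Rrightarrow> \<Delta> |\<union>| \<Delta>')"
    proof (cases "x |\<in>| \<Gamma>'")
      case True
      then show ?thesis
        using insert.prems(1) by (simp add: finsert_absorb)
    next
      case False
      then show ?thesis
        using insert.prems NegNeg_left[of x "\<Gamma> |\<union>| \<Gamma>'"] by auto
    qed
    then show ?case
      using insert.IH insert.prems(2) by blast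
  qed simp
  then show ?thesis
    using right
  proof (induction \<Delta>)
    case (insert x \<Delta>)
    have "provable M (\<Gamma>' \<Rrightarrow> \<Delta> |\<union>| \<Delta>')"
    proof (cases "x |\<in>| \<Delta>'")
      case True
      then show ?thesis
        using insert.prems(1) by (simp add: finsert_absorb)
    next
      case False
      then show ?thesis
        using insert.prems NegNeg_right[of \<Gamma>' x "\<Delta> |\<union>| \<Delta>'"] by auto
    qed
    then show ?case
      using insert.IH insert.prems(2) by blast
  qed simp
qed

text \<open>Strips one negation and changes sides. If \<open>Neg \<alpha>\<close> is on the left or
  \<alpha> on the right, then \<alpha> already occurs on the right up to crossing. If
  \<open>Neg (Neg \<alpha>)\<close> is on the right, two negations separate it from \<alpha>; then
  \<alpha> is added and erased again by \<open>NegNeg_right\<close>, which is why an enlarged right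
  side must be allowed.\<close>

lemma Neg_left_cross:
  assumes "occ (Neg \<alpha>) \<Gamma> \<Delta>"
    and "\<And>\<Delta>'. \<Delta> |\<subseteq>| \<Delta>' \<Longrightarrow> occ \<alpha> \<Delta>' \<Gamma> \<Longrightarrow> provable M (\<Gamma> \<Rrightarrow> \<Delta>')"
  shows "provable M (\<Gamma> \<Rrightarrow> \<Delta>)"
proof (cases "Neg (Neg \<alpha>) |\<in>| \<Delta>")
  case True
  then show ?thesis
    using assms(2)[of "finsert \<alpha> \<Delta>"] NegNeg_right by (auto simp: occ_def)
next
  case False
  then show ?thesis
    using assms by (auto simp: occ_def)
qed

lemma Neg_right_cross:
  assumes "occ (Neg \<alpha>) \<Delta> \<Gamma>"
    and "\<And>\<Gamma>'. \<Gamma> |\<subseteq>| \<Gamma>' \<Longrightarrow> occ \<alpha> \<Gamma>' \<Delta> \<Longrightarrow> provable M (\<Gamma>' \<Rrightarrow> \<Delta>)"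
  shows "provable M (\<Gamma> \<Rrightarrow> \<Delta>)"
proof (cases "Neg (Neg \<alpha>) |\<in>| \<Gamma>")
  case True
  then show ?thesis
    using assms(2)[of "finsert \<alpha> \<Gamma>"] NegNeg_left by (auto simp: occ_def)
next
  case False
  then show ?thesis
    using assms by (auto simp: occ_def)
qed

section \<open>Crossed initial sequents and twin rules for the connectives\<close>

text \<open>Each of the two occurrences is either plain or negated on the opposite side. The four
  combinations are exactly the four kinds of initial sequents, up to weakening.\<close>

lemma Var_cross:
  assumes "occ (Var p) \<Gamma> \<Delta>" "occ (Var p) \<Delta> \<Gamma>"
  shows "provable M (\<Gamma> \<Rrightarrow> \<Delta>)"
proof -
  have "provable M ({|Var p|} \<Rrightarrow> {|Var p|})" "provable M ({|Neg (Var p)|} \<Rrightarrow> {|Neg (Var p)|})"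
    "provable M ({|Neg (Var p), Var p|} \<Rrightarrow> {||})" "provable M ({||} \<Rrightarrow> {|Neg (Var p), Var p|})"
    using common by (auto intro!: rule_instance.intros(1-4)[THEN provable0] simp: common_def)
  then show ?thesis
    using assms by (auto simp: occ_def intro: provable_weaken)
qed

text \<open>A conjunction is not a negation, so it is present either as itself or negated on the
  other side. \<open>AndLeft\<close> and \<open>NegAndRight\<close> have the same premise and cover
  these two cases. The lemmas up to \<open>Dia_right_cross\<close> rest on analogous pairs of
  rules.\<close>

lemma Con_left_cross:
  assumes "occ (\<alpha> \<^bold>\<and> \<beta>) \<Gamma> \<Delta>" "provable M (finsert \<alpha> (finsert \<beta> \<Gamma>) \<Rrightarrow> \<Delta>)"
  shows "provable M (\<Gamma> \<Rrightarrow> \<Delta>)"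
  using assms common provable1[OF rule_instance.intros(8)[of \<alpha> \<beta> \<Gamma> \<Delta>], of M]
    provable1[OF rule_instance.intros(21)[of \<alpha> \<beta> \<Gamma> \<Delta>], of M]
  by (auto simp: occ_def common_def finsert_absorb)

lemma Con_right_cross:
  assumes "occ (\<alpha> \<^bold>\<and> \<beta>) \<Delta> \<Gamma>"
    "provable M (\<Gamma> \<Rrightarrow> finsert \<alpha> \<Delta>)" "provable M (\<Gamma> \<Rrightarrow> finsert \<beta> \<Delta>)"
  shows "provable M (\<Gamma> \<Rrightarrow> \<Delta>)"
  using assms common provable2[OF rule_instance.intros(9)[of \<Gamma> \<alpha> \<Delta> \<beta>], of M]
    provable2[OF rule_instance.intros(20)[of \<Gamma> \<alpha> \<Delta> \<beta>], of M]
  by (auto simp: occ_def common_def finsert_absorb)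

lemma Dis_left_cross:
  assumes "occ (\<alpha> \<^bold>\<or> \<beta>) \<Gamma> \<Delta>"
    "provable M (finsert \<alpha> \<Gamma> \<Rrightarrow> \<Delta>)" "provable M (finsert \<beta> \<Gamma> \<Rrightarrow> \<Delta>)"
  shows "provable M (\<Gamma> \<Rrightarrow> \<Delta>)"
  using assms common provable2[OF rule_instance.intros(10)[of \<alpha> \<Gamma> \<Delta> \<beta>], of M]
    provable2[OF rule_instance.intros(23)[of \<alpha> \<Gamma> \<Delta> \<beta>], of M]
  by (auto simp: occ_def common_def finsert_absorb)

lemma Dis_right_cross:
  assumes "occ (\<alpha> \<^bold>\<or> \<beta>) \<Delta> \<Gamma>" "provable M (\<Gamma> \<Rrightarrow> finsert \<alpha> (finsert \<beta> \<Delta>))"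
  shows "provable M (\<Gamma> \<Rrightarrow> \<Delta>)"
  using assms common provable1[OF rule_instance.intros(11)[of \<Gamma> \<alpha> \<beta> \<Delta>], of M]
    provable1[OF rule_instance.intros(22)[of \<Gamma> \<alpha> \<beta> \<Delta>], of M]
  by (auto simp: occ_def common_def finsert_absorb)

lemma Imp_left_cross:
  assumes "occ (\<alpha> \<^bold>\<rightarrow> \<beta>) \<Gamma> \<Delta>"
    "provable M (\<Gamma> \<Rrightarrow> finsert \<alpha> \<Delta>)" "provable M (finsert \<beta> \<Gamma> \<Rrightarrow> \<Delta>)"
  shows "provable M (\<Gamma> \<Rrightarrow> \<Delta>)"
  using assms common provable2[OF rule_instance.intros(12)[of \<Gamma> \<alpha> \<Delta> \<beta>], of M]
    provable2[OF rule_instance.intros(25)[of \<Gamma> \<alpha> \<Delta> \<beta>], of M]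
  by (auto simp: occ_def common_def finsert_absorb)

lemma Imp_right_cross:
  assumes "occ (\<alpha> \<^bold>\<rightarrow> \<beta>) \<Delta> \<Gamma>" "provable M (finsert \<alpha> \<Gamma> \<Rrightarrow> finsert \<beta> \<Delta>)"
  shows "provable M (\<Gamma> \<Rrightarrow> \<Delta>)"
  using assms common provable1[OF rule_instance.intros(13)[of \<alpha> \<Gamma> \<beta> \<Delta>], of M]
    provable1[OF rule_instance.intros(24)[of \<alpha> \<Gamma> \<beta> \<Delta>], of M]
  by (auto simp: occ_def common_def finsert_absorb)

lemma Box_left_cross:
  assumes "occ (Box \<alpha>) \<Gamma> \<Delta>" "provable M (finsert \<alpha> \<Gamma> \<Rrightarrow> \<Delta>)"
  shows "provable M (\<Gamma> \<Rrightarrow> \<Delta>)"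
  using assms common provable1[OF rule_instance.intros(14)[of \<alpha> \<Gamma> \<Delta>], of M]
    provable1[OF rule_instance.intros(27)[of \<alpha> \<Gamma> \<Delta>], of M]
  by (auto simp: occ_def common_def finsert_absorb)

lemma Dia_right_cross:
  assumes "occ (Dia \<alpha>) \<Delta> \<Gamma>" "provable M (\<Gamma> \<Rrightarrow> finsert \<alpha> \<Delta>)"
  shows "provable M (\<Gamma> \<Rrightarrow> \<Delta>)"
  using assms common provable1[OF rule_instance.intros(17)[of \<Gamma> \<alpha> \<Delta>], of M]
    provable1[OF rule_instance.intros(28)[of \<Gamma> \<alpha> \<Delta>], of M]
  by (auto simp: occ_def common_def finsert_absorb)

text \<open>The premises cross into the target enlarged by the active formulas, where the induction
  hypothesis applies; a twin rule then absorbs these into the crossed principal formula. A negated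
  principal formula is first stripped by \<open>Neg_left_cross\<close> or
  \<open>Neg_right_cross\<close>.\<close>

lemma provable_cross_common:
  assumes "rule_instance r Ss S" "r \<in> common"
    and IH: "\<And>S' T. S' \<in> set Ss \<Longrightarrow> crosses S' T \<Longrightarrow> provable M T"
    and "crosses S (\<Gamma>' \<Rrightarrow> \<Delta>')"
  shows "provable M (\<Gamma>' \<Rrightarrow> \<Delta>')"
proof -
  have IH1: "provable M T" if "Ss = S1 # Ss'" "crosses S1 T" for S1 Ss' T
    using IH that by auto
  have IH2: "provable M T" if "Ss = S1 # S2 # Ss'" "crosses S2 T" for S1 S2 Ss' T
    using IH that by auto
  show ?thesis
    using assms(1)
  proof cases
    case (1 p)
    then show ?thesis
      using assms(4) by (auto intro: Var_cross)
  next
    case (2 p)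
    then have occ: "occ (Neg (Var p)) \<Gamma>' \<Delta>'" "occ (Neg (Var p)) \<Delta>' \<Gamma>'"
      using assms(4) by auto
    show ?thesis
    \<comment> \<open>Stripping both negations exchanges the two occurrences and leaves a crossed
      \<open>Var p\<close> on each side. As each stripping may enlarge a side, the other occurrence
      is carried along by \<open>occ_mono\<close>.\<close>
    proof (rule Neg_left_cross[OF occ(1)])
      fix \<Delta>''
      assume *: "\<Delta>' |\<subseteq>| \<Delta>''" "occ (Var p) \<Delta>'' \<Gamma>'"
      show "provable M (\<Gamma>' \<Rrightarrow> \<Delta>'')"
      proof (rule Neg_right_cross)
        show "occ (Neg (Var p)) \<Delta>'' \<Gamma>'"
          using occ_mono[OF occ(2)] * by simp
      next
        fix \<Gamma>''
        assume "\<Gamma>' |\<subseteq>| \<Gamma>''" "occ (Var p) \<Gamma>'' \<Delta>''"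
        then show "provable M (\<Gamma>'' \<Rrightarrow> \<Delta>'')"
          using Var_cross occ_mono[OF *(2)] by simp
      qed
    qed
  next
    case (3 p)
    then have occ: "occ (Neg (Var p)) \<Gamma>' \<Delta>'" "occ (Var p) \<Gamma>' \<Delta>'"
      using assms(4) by auto
    show ?thesis
      by (rule Neg_left_cross[OF occ(1)], rule Var_cross[of p]) (use occ_mono[OF occ(2)] in simp_all)
  next
    case (4 p)
    then have occ: "occ (Neg (Var p)) \<Delta>' \<Gamma>'" "occ (Var p) \<Delta>' \<Gamma>'"
      using assms(4) by auto
    show ?thesis
      by (rule Neg_right_cross[OF occ(1)], rule Var_cross[of p]) (use occ_mono[OF occ(2)] in simp_all)
  next
    \<comment> \<open>Undoing a weakening only drops a condition from \<open>crosses\<close>, so the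
      premise crosses into the same target.\<close>
    case 6
    then show ?thesis
      using assms(4) IH1 by auto
  next
    case 7
    then show ?thesis
      using assms(4) IH1 by auto
  next
    case (18 \<alpha> \<Gamma> \<Delta>)
    note c = assms(4)[unfolded 18(3)]
    \<comment> \<open>Two negations are stripped in turn, the first moving to the right and the
      second back to the left. Hence the induction hypothesis is needed with both sides
      enlarged.\<close>
    have "provable M (\<Gamma>'' \<Rrightarrow> \<Delta>'')"
      if "\<Delta>' |\<subseteq>| \<Delta>''" "\<Gamma>' |\<subseteq>| \<Gamma>''" "occ \<alpha> \<Gamma>'' \<Delta>''" for \<Delta>'' \<Gamma>''
      by (rule IH1[OF 18(2)]) (use c that in \<open>auto elim: crosses_mono\<close>)
    then have "provable M (\<Gamma>' \<Rrightarrow> \<Delta>'')"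
      if "\<Delta>' |\<subseteq>| \<Delta>''" "occ (Neg \<alpha>) \<Delta>'' \<Gamma>'" for \<Delta>''
      using that Neg_right_cross[of \<alpha>] by blast
    then show ?thesis
      using c Neg_left_cross[of "Neg \<alpha>"] by auto
  next
    case (19 \<Gamma> \<alpha> \<Delta>)
    note c = assms(4)[unfolded 19(3)]
    have "provable M (\<Gamma>'' \<Rrightarrow> \<Delta>'')"
      if "\<Gamma>' |\<subseteq>| \<Gamma>''" "\<Delta>' |\<subseteq>| \<Delta>''" "occ \<alpha> \<Delta>'' \<Gamma>''" for \<Gamma>'' \<Delta>''
      by (rule IH1[OF 19(2)]) (use c that in \<open>auto elim: crosses_mono\<close>)
    then have "provable M (\<Gamma>'' \<Rrightarrow> \<Delta>')"
      if "\<Gamma>' |\<subseteq>| \<Gamma>''" "occ (Neg \<alpha>) \<Gamma>'' \<Delta>'" for \<Gamma>''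
      using that Neg_left_cross[of \<alpha>] by blast
    then show ?thesis
      using c Neg_right_cross[of "Neg \<alpha>"] by auto
  next
    case (8 \<alpha> \<beta> \<Gamma> \<Delta>)
    note c = assms(4)[unfolded 8(3)]
    show ?thesis
      by (rule Con_left_cross[of \<alpha> \<beta>], use c in simp, rule IH1[OF 8(2)])
        (use c in \<open>auto elim: crosses_mono\<close>)
  next
    case (9 \<Gamma> \<alpha> \<Delta> \<beta>)
    note c = assms(4)[unfolded 9(3)]
    show ?thesis
    proof (rule Con_right_cross[of \<alpha> \<beta>], use c in simp)
      show "provable M (\<Gamma>' \<Rrightarrow> finsert \<alpha> \<Delta>')"
        by (rule IH1[OF 9(2)]) (use c in \<open>auto elim: crosses_mono\<close>)
      show "provable M (\<Gamma>' \<Rrightarrow> finsert \<beta> \<Delta>')"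
        by (rule IH2[OF 9(2)]) (use c in \<open>auto elim: crosses_mono\<close>)
    qed
  next
    case (10 \<alpha> \<Gamma> \<Delta> \<beta>)
    note c = assms(4)[unfolded 10(3)]
    show ?thesis
    proof (rule Dis_left_cross[of \<alpha> \<beta>], use c in simp)
      show "provable M (finsert \<alpha> \<Gamma>' \<Rrightarrow> \<Delta>')"
        by (rule IH1[OF 10(2)]) (use c in \<open>auto elim: crosses_mono\<close>)
      show "provable M (finsert \<beta> \<Gamma>' \<Rrightarrow> \<Delta>')"
        by (rule IH2[OF 10(2)]) (use c in \<open>auto elim: crosses_mono\<close>)
    qed
  next
    case (11 \<Gamma> \<alpha> \<beta> \<Delta>)
    note c = assms(4)[unfolded 11(3)]
    show ?thesis
      by (rule Dis_right_cross[of \<alpha> \<beta>], use c in simp, rule IH1[OF 11(2)])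
        (use c in \<open>auto elim: crosses_mono\<close>)
  next
    case (12 \<Gamma> \<alpha> \<Delta> \<beta>)
    note c = assms(4)[unfolded 12(3)]
    show ?thesis
    proof (rule Imp_left_cross[of \<alpha> \<beta>], use c in simp)
      show "provable M (\<Gamma>' \<Rrightarrow> finsert \<alpha> \<Delta>')"
        by (rule IH1[OF 12(2)]) (use c in \<open>auto elim: crosses_mono\<close>)
      show "provable M (finsert \<beta> \<Gamma>' \<Rrightarrow> \<Delta>')"
        by (rule IH2[OF 12(2)]) (use c in \<open>auto elim: crosses_mono\<close>)
    qed
  next
    case (13 \<alpha> \<Gamma> \<beta> \<Delta>)
    note c = assms(4)[unfolded 13(3)]
    show ?thesis
      by (rule Imp_right_cross[of \<alpha> \<beta>], use c in simp, rule IH1[OF 13(2)])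
        (use c in \<open>auto elim: crosses_mono\<close>)
  next
    case (14 \<alpha> \<Gamma> \<Delta>)
    note c = assms(4)[unfolded 14(3)]
    show ?thesis
      by (rule Box_left_cross[of \<alpha>], use c in simp, rule IH1[OF 14(2)])
        (use c in \<open>auto elim: crosses_mono\<close>)
  next
    case (17 \<Gamma> \<alpha> \<Delta>)
    note c = assms(4)[unfolded 17(3)]
    show ?thesis
      by (rule Dia_right_cross[of \<alpha>], use c in simp, rule IH1[OF 17(2)])
        (use c in \<open>auto elim: crosses_mono\<close>)
  next
    case (20 \<Gamma> \<alpha> \<Delta> \<beta>)
    note c = assms(4)[unfolded 20(3)]
    \<comment> \<open>Once the outer negation is stripped, the rule behaves like its twin for the
      unnegated formula on the other side. The other rules with negated principal formulas below
      follow this pattern.\<close>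
    have "provable M (\<Gamma>' \<Rrightarrow> \<Delta>'')"
      if "\<Delta>' |\<subseteq>| \<Delta>''" "occ (\<alpha> \<^bold>\<and> \<beta>) \<Delta>'' \<Gamma>'" for \<Delta>''
    proof (rule Con_right_cross[OF that(2)])
      show "provable M (\<Gamma>' \<Rrightarrow> finsert \<alpha> \<Delta>'')"
        by (rule IH1[OF 20(2)]) (use c that(1) in \<open>auto elim: crosses_mono\<close>)
      show "provable M (\<Gamma>' \<Rrightarrow> finsert \<beta> \<Delta>'')"
        by (rule IH2[OF 20(2)]) (use c that(1) in \<open>auto elim: crosses_mono\<close>)
    qed
    then show ?thesis
      using c Neg_left_cross[of "\<alpha> \<^bold>\<and> \<beta>"] by auto
  next
    case (21 \<alpha> \<beta> \<Gamma> \<Delta>)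
    note c = assms(4)[unfolded 21(3)]
    have "provable M (\<Gamma>'' \<Rrightarrow> \<Delta>')"
      if "\<Gamma>' |\<subseteq>| \<Gamma>''" "occ (\<alpha> \<^bold>\<and> \<beta>) \<Gamma>'' \<Delta>'" for \<Gamma>''
      by (rule Con_left_cross[OF that(2)], rule IH1[OF 21(2)])
        (use c that(1) in \<open>auto elim: crosses_mono\<close>)
    then show ?thesis
      using c Neg_right_cross[of "\<alpha> \<^bold>\<and> \<beta>"] by auto
  next
    case (22 \<Gamma> \<alpha> \<beta> \<Delta>)
    note c = assms(4)[unfolded 22(3)]
    have "provable M (\<Gamma>' \<Rrightarrow> \<Delta>'')"
      if "\<Delta>' |\<subseteq>| \<Delta>''" "occ (\<alpha> \<^bold>\<or> \<beta>) \<Delta>'' \<Gamma>'" for \<Delta>''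
      by (rule Dis_right_cross[OF that(2)], rule IH1[OF 22(2)])
        (use c that(1) in \<open>auto elim: crosses_mono\<close>)
    then show ?thesis
      using c Neg_left_cross[of "\<alpha> \<^bold>\<or> \<beta>"] by auto
  next
    case (23 \<alpha> \<Gamma> \<Delta> \<beta>)
    note c = assms(4)[unfolded 23(3)]
    have "provable M (\<Gamma>'' \<Rrightarrow> \<Delta>')"
      if "\<Gamma>' |\<subseteq>| \<Gamma>''" "occ (\<alpha> \<^bold>\<or> \<beta>) \<Gamma>'' \<Delta>'" for \<Gamma>''
    proof (rule Dis_left_cross[OF that(2)])
      show "provable M (finsert \<alpha> \<Gamma>'' \<Rrightarrow> \<Delta>')"
        by (rule IH1[OF 23(2)]) (use c that(1) in \<open>auto elim: crosses_mono\<close>)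
      show "provable M (finsert \<beta> \<Gamma>'' \<Rrightarrow> \<Delta>')"
        by (rule IH2[OF 23(2)]) (use c that(1) in \<open>auto elim: crosses_mono\<close>)
    qed
    then show ?thesis
      using c Neg_right_cross[of "\<alpha> \<^bold>\<or> \<beta>"] by auto
  next
    case (24 \<alpha> \<Gamma> \<beta> \<Delta>)
    note c = assms(4)[unfolded 24(3)]
    have "provable M (\<Gamma>' \<Rrightarrow> \<Delta>'')"
      if "\<Delta>' |\<subseteq>| \<Delta>''" "occ (\<alpha> \<^bold>\<rightarrow> \<beta>) \<Delta>'' \<Gamma>'" for \<Delta>''
      by (rule Imp_right_cross[OF that(2)], rule IH1[OF 24(2)])
        (use c that(1) in \<open>auto elim: crosses_mono\<close>)
    then show ?thesis
      using c Neg_left_cross[of "\<alpha> \<^bold>\<rightarrow> \<beta>"] by auto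
  next
    case (25 \<Gamma> \<alpha> \<Delta> \<beta>)
    note c = assms(4)[unfolded 25(3)]
    have "provable M (\<Gamma>'' \<Rrightarrow> \<Delta>')"
      if "\<Gamma>' |\<subseteq>| \<Gamma>''" "occ (\<alpha> \<^bold>\<rightarrow> \<beta>) \<Gamma>'' \<Delta>'" for \<Gamma>''
    proof (rule Imp_left_cross[OF that(2)])
      show "provable M (\<Gamma>'' \<Rrightarrow> finsert \<alpha> \<Delta>')"
        by (rule IH1[OF 25(2)]) (use c that(1) in \<open>auto elim: crosses_mono\<close>)
      show "provable M (finsert \<beta> \<Gamma>'' \<Rrightarrow> \<Delta>')"
        by (rule IH2[OF 25(2)]) (use c that(1) in \<open>auto elim: crosses_mono\<close>)
    qed
    then show ?thesis
      using c Neg_right_cross[of "\<alpha> \<^bold>\<rightarrow> \<beta>"] by auto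
  next
    case (27 \<alpha> \<Gamma> \<Delta>)
    note c = assms(4)[unfolded 27(3)]
    have "provable M (\<Gamma>'' \<Rrightarrow> \<Delta>')"
      if "\<Gamma>' |\<subseteq>| \<Gamma>''" "occ (Box \<alpha>) \<Gamma>'' \<Delta>'" for \<Gamma>''
      by (rule Box_left_cross[OF that(2)], rule IH1[OF 27(2)])
        (use c that(1) in \<open>auto elim: crosses_mono\<close>)
    then show ?thesis
      using c Neg_right_cross[of "Box \<alpha>"] by auto
  next
    case (28 \<Gamma> \<alpha> \<Delta>)
    note c = assms(4)[unfolded 28(3)]
    have "provable M (\<Gamma>' \<Rrightarrow> \<Delta>'')"
      if "\<Delta>' |\<subseteq>| \<Delta>''" "occ (Dia \<alpha>) \<Delta>'' \<Gamma>'" for \<Delta>''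
      by (rule Dia_right_cross[OF that(2)], rule IH1[OF 28(2)])
        (use c that(1) in \<open>auto elim: crosses_mono\<close>)
    then show ?thesis
      using c Neg_left_cross[of "Dia \<alpha>"] by auto
  \<comment> \<open>The remaining rules, \<open>Cut\<close> among them, are not in
    \<open>common\<close>.\<close>
  qed (use assms(2) in \<open>simp_all add: common_def\<close>)
qed

text \<open>
  In a modal context, a boxed formula on the left is exchangeable with its negation on the right,
  and dually for diamonds, so the crossed context is again modal, up to double negations.
\<close>

lemma modal_context_cross:
  assumes "crosses (Boxes \<Gamma>\<^sub>1 |\<union>| NegDias \<Gamma>\<^sub>2 \<Rrightarrow> Dias \<Delta>\<^sub>1 |\<union>| NegBoxes \<Delta>\<^sub>2) (\<Gamma>' \<Rrightarrow> \<Delta>')"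
  obtains \<Phi>\<^sub>1 \<Phi>\<^sub>2 \<Psi>\<^sub>1 \<Psi>\<^sub>2 where
    "\<Phi>\<^sub>1 |\<union>| \<Psi>\<^sub>2 = \<Gamma>\<^sub>1 |\<union>| \<Delta>\<^sub>2" "\<Psi>\<^sub>1 |\<union>| \<Phi>\<^sub>2 = \<Delta>\<^sub>1 |\<union>| \<Gamma>\<^sub>2"
    "\<And>X Y. provable M (X |\<union>| (Boxes \<Phi>\<^sub>1 |\<union>| NegDias \<Phi>\<^sub>2) \<Rrightarrow> Y |\<union>| (Dias \<Psi>\<^sub>1 |\<union>| NegBoxes \<Psi>\<^sub>2)) \<Longrightarrow>
       (\<And>\<phi>. \<phi> |\<in>| X \<Longrightarrow> \<phi> |\<in>| \<Gamma>' \<or> Neg (Neg \<phi>) |\<in>| \<Gamma>') \<Longrightarrow>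
       (\<And>\<phi>. \<phi> |\<in>| Y \<Longrightarrow> \<phi> |\<in>| \<Delta>' \<or> Neg (Neg \<phi>) |\<in>| \<Delta>') \<Longrightarrow> provable M (\<Gamma>' \<Rrightarrow> \<Delta>')"
proof -
  \<comment> \<open>The bodies of boxes from both sides are pooled and redistributed according to
    where the target shows them, and likewise those of diamonds. A body may land in both parts.
    \<open>\<Phi>\<^sub>1\<close> and \<open>\<Psi>\<^sub>1\<close> also collect the doubly negated
    forms, which \<open>provable_weaken_NegNeg\<close> can restore.\<close>
  define \<Phi>\<^sub>1 where
    "\<Phi>\<^sub>1 = ffilter (\<lambda>\<gamma>. Box \<gamma> |\<in>| \<Gamma>' \<or> Neg (Neg (Box \<gamma>)) |\<in>| \<Gamma>') (\<Gamma>\<^sub>1 |\<union>| \<Delta>\<^sub>2)"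
  define \<Psi>\<^sub>2 where "\<Psi>\<^sub>2 = ffilter (\<lambda>\<gamma>. Neg (Box \<gamma>) |\<in>| \<Delta>') (\<Gamma>\<^sub>1 |\<union>| \<Delta>\<^sub>2)"
  define \<Psi>\<^sub>1 where
    "\<Psi>\<^sub>1 = ffilter (\<lambda>\<gamma>. Dia \<gamma> |\<in>| \<Delta>' \<or> Neg (Neg (Dia \<gamma>)) |\<in>| \<Delta>') (\<Delta>\<^sub>1 |\<union>| \<Gamma>\<^sub>2)"
  define \<Phi>\<^sub>2 where "\<Phi>\<^sub>2 = ffilter (\<lambda>\<gamma>. Neg (Dia \<gamma>) |\<in>| \<Gamma>') (\<Delta>\<^sub>1 |\<union>| \<Gamma>\<^sub>2)"
  note sets = \<Phi>\<^sub>1_def \<Psi>\<^sub>2_def \<Psi>\<^sub>1_def \<Phi>\<^sub>2_def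
  have occ: "\<gamma> |\<in>| \<Gamma>\<^sub>1 \<Longrightarrow> occ (Box \<gamma>) \<Gamma>' \<Delta>'" "\<gamma> |\<in>| \<Delta>\<^sub>2 \<Longrightarrow> occ (Neg (Box \<gamma>)) \<Delta>' \<Gamma>'"
    "\<gamma> |\<in>| \<Delta>\<^sub>1 \<Longrightarrow> occ (Dia \<gamma>) \<Delta>' \<Gamma>'" "\<gamma> |\<in>| \<Gamma>\<^sub>2 \<Longrightarrow> occ (Neg (Dia \<gamma>)) \<Gamma>' \<Delta>'" for \<gamma>
    using assms by (simp_all add: crosses.simps)
  \<comment> \<open>A crossed box from the left and a crossed negated box from the right leave
    traces of the same three kinds, so their origin can be forgotten.\<close>
  have Box: "Box \<gamma> |\<in>| \<Gamma>' \<or> Neg (Neg (Box \<gamma>)) |\<in>| \<Gamma>' \<or> Neg (Box \<gamma>) |\<in>| \<Delta>'"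
    if "\<gamma> |\<in>| \<Gamma>\<^sub>1 \<or> \<gamma> |\<in>| \<Delta>\<^sub>2" for \<gamma>
    using occ(1,2)[of \<gamma>] that by (auto simp: occ_def)
  have Dia: "Dia \<gamma> |\<in>| \<Delta>' \<or> Neg (Neg (Dia \<gamma>)) |\<in>| \<Delta>' \<or> Neg (Dia \<gamma>) |\<in>| \<Gamma>'"
    if "\<gamma> |\<in>| \<Delta>\<^sub>1 \<or> \<gamma> |\<in>| \<Gamma>\<^sub>2" for \<gamma>
    using occ(3,4)[of \<gamma>] that by (auto simp: occ_def)
  show thesis
  proof
    show "\<Phi>\<^sub>1 |\<union>| \<Psi>\<^sub>2 = \<Gamma>\<^sub>1 |\<union>| \<Delta>\<^sub>2" "\<Psi>\<^sub>1 |\<union>| \<Phi>\<^sub>2 = \<Delta>\<^sub>1 |\<union>| \<Gamma>\<^sub>2"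
      by (auto simp: sets dest: Box[OF disjI1] Box[OF disjI2] Dia[OF disjI1] Dia[OF disjI2])
  next
    fix X Y
    assume prov: "provable M (X |\<union>| (Boxes \<Phi>\<^sub>1 |\<union>| NegDias \<Phi>\<^sub>2) \<Rrightarrow> Y |\<union>| (Dias \<Psi>\<^sub>1 |\<union>| NegBoxes \<Psi>\<^sub>2))"
      and X: "\<And>\<phi>. \<phi> |\<in>| X \<Longrightarrow> \<phi> |\<in>| \<Gamma>' \<or> Neg (Neg \<phi>) |\<in>| \<Gamma>'"
      and Y: "\<And>\<phi>. \<phi> |\<in>| Y \<Longrightarrow> \<phi> |\<in>| \<Delta>' \<or> Neg (Neg \<phi>) |\<in>| \<Delta>'"
    show "provable M (\<Gamma>' \<Rrightarrow> \<Delta>')"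
      by (rule provable_weaken_NegNeg[OF prov]) (auto simp: sets dest: X Y)
  qed
qed

text \<open>A box on the right and a negated box on the left are exchanged by crossing, so both
  conclusions over the rearranged context must be at hand. Formulating this without a premise makes
  it usable for either calculus.\<close>

lemma Box_principal_cross:
  assumes "crosses (Boxes \<Gamma>\<^sub>1 |\<union>| NegDias \<Gamma>\<^sub>2 \<Rrightarrow> Dias \<Delta>\<^sub>1 |\<union>| NegBoxes \<Delta>\<^sub>2) (\<Gamma>' \<Rrightarrow> \<Delta>')"
    and "occ (Box \<alpha>) \<Delta>' \<Gamma>' \<or> occ (Neg (Box \<alpha>)) \<Gamma>' \<Delta>'"
    and "\<And>\<Phi>\<^sub>1 \<Phi>\<^sub>2 \<Psi>\<^sub>1 \<Psi>\<^sub>2. \<Phi>\<^sub>1 |\<union>| \<Psi>\<^sub>2 = \<Gamma>\<^sub>1 |\<union>| \<Delta>\<^sub>2 \<Longrightarrow> \<Psi>\<^sub>1 |\<union>| \<Phi>\<^sub>2 = \<Delta>\<^sub>1 |\<union>| \<Gamma>\<^sub>2 \<Longrightarrow>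
      provable M (Boxes \<Phi>\<^sub>1 |\<union>| NegDias \<Phi>\<^sub>2 \<Rrightarrow> finsert (Box \<alpha>) (Dias \<Psi>\<^sub>1 |\<union>| NegBoxes \<Psi>\<^sub>2)) \<and>
      provable M (finsert (Neg (Box \<alpha>)) (Boxes \<Phi>\<^sub>1 |\<union>| NegDias \<Phi>\<^sub>2) \<Rrightarrow> Dias \<Psi>\<^sub>1 |\<union>| NegBoxes \<Psi>\<^sub>2)"
  shows "provable M (\<Gamma>' \<Rrightarrow> \<Delta>')"
proof (rule modal_context_cross[OF assms(1)])
  fix \<Phi>\<^sub>1 \<Phi>\<^sub>2 \<Psi>\<^sub>1 \<Psi>\<^sub>2
  assume "\<Phi>\<^sub>1 |\<union>| \<Psi>\<^sub>2 = \<Gamma>\<^sub>1 |\<union>| \<Delta>\<^sub>2" "\<Psi>\<^sub>1 |\<union>| \<Phi>\<^sub>2 = \<Delta>\<^sub>1 |\<union>| \<Gamma>\<^sub>2"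
  note prov = assms(3)[OF this]
  assume weaken: "\<And>X Y.
    provable M (X |\<union>| (Boxes \<Phi>\<^sub>1 |\<union>| NegDias \<Phi>\<^sub>2) \<Rrightarrow> Y |\<union>| (Dias \<Psi>\<^sub>1 |\<union>| NegBoxes \<Psi>\<^sub>2)) \<Longrightarrow>
    (\<And>\<phi>. \<phi> |\<in>| X \<Longrightarrow> \<phi> |\<in>| \<Gamma>' \<or> Neg (Neg \<phi>) |\<in>| \<Gamma>') \<Longrightarrow>
    (\<And>\<phi>. \<phi> |\<in>| Y \<Longrightarrow> \<phi> |\<in>| \<Delta>' \<or> Neg (Neg \<phi>) |\<in>| \<Delta>') \<Longrightarrow> provable M (\<Gamma>' \<Rrightarrow> \<Delta>')"
  \<comment> \<open>The doubly negated box joins the first case, since \<open>weaken\<close> accepts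
    it in place of the box itself.\<close>
  consider "Box \<alpha> |\<in>| \<Delta>' \<or> Neg (Neg (Box \<alpha>)) |\<in>| \<Delta>'" | "Neg (Box \<alpha>) |\<in>| \<Gamma>'"
    using assms(2) by (auto simp: occ_def)
  then show ?thesis
  proof cases
    case 1
    show ?thesis
      by (rule weaken[of "{||}" "{|Box \<alpha>|}"]) (use 1 prov in auto)
  next
    case 2
    show ?thesis
      by (rule weaken[of "{|Neg (Box \<alpha>)|}" "{||}"]) (use 2 prov in auto)
  qed
qed

text \<open>The dual, for a diamond on the left and a negated diamond on the right.\<close>

lemma Dia_principal_cross:
  assumes "crosses (Boxes \<Gamma>\<^sub>1 |\<union>| NegDias \<Gamma>\<^sub>2 \<Rrightarrow> Dias \<Delta>\<^sub>1 |\<union>| NegBoxes \<Delta>\<^sub>2) (\<Gamma>' \<Rrightarrow> \<Delta>')"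
    and "occ (Dia \<alpha>) \<Gamma>' \<Delta>' \<or> occ (Neg (Dia \<alpha>)) \<Delta>' \<Gamma>'"
    and "\<And>\<Phi>\<^sub>1 \<Phi>\<^sub>2 \<Psi>\<^sub>1 \<Psi>\<^sub>2. \<Phi>\<^sub>1 |\<union>| \<Psi>\<^sub>2 = \<Gamma>\<^sub>1 |\<union>| \<Delta>\<^sub>2 \<Longrightarrow> \<Psi>\<^sub>1 |\<union>| \<Phi>\<^sub>2 = \<Delta>\<^sub>1 |\<union>| \<Gamma>\<^sub>2 \<Longrightarrow>
      provable M (finsert (Dia \<alpha>) (Boxes \<Phi>\<^sub>1 |\<union>| NegDias \<Phi>\<^sub>2) \<Rrightarrow> Dias \<Psi>\<^sub>1 |\<union>| NegBoxes \<Psi>\<^sub>2) \<and>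
      provable M (Boxes \<Phi>\<^sub>1 |\<union>| NegDias \<Phi>\<^sub>2 \<Rrightarrow> finsert (Neg (Dia \<alpha>)) (Dias \<Psi>\<^sub>1 |\<union>| NegBoxes \<Psi>\<^sub>2))"
  shows "provable M (\<Gamma>' \<Rrightarrow> \<Delta>')"
proof (rule modal_context_cross[OF assms(1)])
  fix \<Phi>\<^sub>1 \<Phi>\<^sub>2 \<Psi>\<^sub>1 \<Psi>\<^sub>2
  assume "\<Phi>\<^sub>1 |\<union>| \<Psi>\<^sub>2 = \<Gamma>\<^sub>1 |\<union>| \<Delta>\<^sub>2" "\<Psi>\<^sub>1 |\<union>| \<Phi>\<^sub>2 = \<Delta>\<^sub>1 |\<union>| \<Gamma>\<^sub>2"
  note prov = assms(3)[OF this]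
  assume weaken: "\<And>X Y.
    provable M (X |\<union>| (Boxes \<Phi>\<^sub>1 |\<union>| NegDias \<Phi>\<^sub>2) \<Rrightarrow> Y |\<union>| (Dias \<Psi>\<^sub>1 |\<union>| NegBoxes \<Psi>\<^sub>2)) \<Longrightarrow>
    (\<And>\<phi>. \<phi> |\<in>| X \<Longrightarrow> \<phi> |\<in>| \<Gamma>' \<or> Neg (Neg \<phi>) |\<in>| \<Gamma>') \<Longrightarrow>
    (\<And>\<phi>. \<phi> |\<in>| Y \<Longrightarrow> \<phi> |\<in>| \<Delta>' \<or> Neg (Neg \<phi>) |\<in>| \<Delta>') \<Longrightarrow> provable M (\<Gamma>' \<Rrightarrow> \<Delta>')"
  consider "Dia \<alpha> |\<in>| \<Gamma>' \<or> Neg (Neg (Dia \<alpha>)) |\<in>| \<Gamma>'" | "Neg (Dia \<alpha>) |\<in>| \<Delta>'"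
    using assms(2) by (auto simp: occ_def)
  then show ?thesis
  proof cases
    case 1
    show ?thesis
      by (rule weaken[of "{|Dia \<alpha>|}" "{||}"]) (use 1 prov in auto)
  next
    case 2
    show ?thesis
      by (rule weaken[of "{||}" "{|Neg (Dia \<alpha>)|}"]) (use 2 prov in auto)
  qed
qed

end

section \<open>Invariance of provability under crossing in each calculus\<close>

text \<open>By the equal unions, every body of a box keeps a place, as a box on the left or a
  negated box on the right; this is the exchange that \<open>occ\<close> permits. Diamonds are
  dual.\<close>

lemma crosses_modal_context:
  assumes "\<Phi>\<^sub>1 |\<union>| \<Psi>\<^sub>2 = \<Gamma>\<^sub>1 |\<union>| \<Delta>\<^sub>2" "\<Psi>\<^sub>1 |\<union>| \<Phi>\<^sub>2 = \<Delta>\<^sub>1 |\<union>| \<Gamma>\<^sub>2"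
  shows "crosses (Boxes \<Gamma>\<^sub>1 |\<union>| NegDias \<Gamma>\<^sub>2 \<Rrightarrow> Dias \<Delta>\<^sub>1 |\<union>| NegBoxes \<Delta>\<^sub>2)
    (Boxes \<Phi>\<^sub>1 |\<union>| NegDias \<Phi>\<^sub>2 \<Rrightarrow> Dias \<Psi>\<^sub>1 |\<union>| NegBoxes \<Psi>\<^sub>2)"
proof -
  have "\<gamma> |\<in>| \<Phi>\<^sub>1 \<or> \<gamma> |\<in>| \<Psi>\<^sub>2" if "\<gamma> |\<in>| \<Gamma>\<^sub>1 \<or> \<gamma> |\<in>| \<Delta>\<^sub>2" for \<gamma>
    using assms(1) that by (metis funion_iff)
  moreover have "\<gamma> |\<in>| \<Psi>\<^sub>1 \<or> \<gamma> |\<in>| \<Phi>\<^sub>2" if "\<gamma> |\<in>| \<Delta>\<^sub>1 \<or> \<gamma> |\<in>| \<Gamma>\<^sub>2" for \<gamma>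
    using assms(2) that by (metis funion_iff)
  ultimately show ?thesis
    by (fastforce simp: crosses.simps occ_def)
qed

text \<open>In the restricted modal rules the premise has the same context as the conclusion, so the
  premise is crossed into the rearranged context by the induction hypothesis before the rule is
  applied.\<close>

lemma provable_cross_lTS4:
  assumes "provable (cut_free lTS4) S" "crosses S T"
  shows "provable (cut_free lTS4) T"
  using assms
proof (induction arbitrary: T)
  case (1 r Ss S)
  let ?M = "cut_free lTS4"
  obtain \<Gamma>' \<Delta>' where T: "T = (\<Gamma>' \<Rrightarrow> \<Delta>')"
    by (cases T)
  have M: "common \<subseteq> ?M" "BoxRight \<in> ?M" "DiaLeft \<in> ?M" "NegBoxLeft \<in> ?M" "NegDiaRight \<in> ?M"
    by (auto simp: cut_free_lTS4)
  have IH: "provable ?M T'" if "Ss = [S']" "crosses S' T'" for S' T'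
    using 1 that by auto
  \<comment> \<open>\<open>BoxRight\<close> and \<open>NegBoxLeft\<close> have the same premise and
    are treated together; \<open>dia\<close> does the same for \<open>DiaLeft\<close> and
    \<open>NegDiaRight\<close>.\<close>
  have box: ?case
    if "Ss = [Boxes \<Gamma>\<^sub>1 |\<union>| NegDias \<Gamma>\<^sub>2 \<Rrightarrow> finsert \<alpha> (Dias \<Delta>\<^sub>1 |\<union>| NegBoxes \<Delta>\<^sub>2)]"
      "crosses (Boxes \<Gamma>\<^sub>1 |\<union>| NegDias \<Gamma>\<^sub>2 \<Rrightarrow> Dias \<Delta>\<^sub>1 |\<union>| NegBoxes \<Delta>\<^sub>2) (\<Gamma>' \<Rrightarrow> \<Delta>')"
      "occ (Box \<alpha>) \<Delta>' \<Gamma>' \<or> occ (Neg (Box \<alpha>)) \<Gamma>' \<Delta>'" for \<Gamma>\<^sub>1 \<Gamma>\<^sub>2 \<alpha> \<Delta>\<^sub>1 \<Delta>\<^sub>2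
    unfolding T
  proof (rule Box_principal_cross[OF M(1) that(2,3)])
    fix \<Phi>\<^sub>1 \<Phi>\<^sub>2 \<Psi>\<^sub>1 \<Psi>\<^sub>2
    assume "\<Phi>\<^sub>1 |\<union>| \<Psi>\<^sub>2 = \<Gamma>\<^sub>1 |\<union>| \<Delta>\<^sub>2" "\<Psi>\<^sub>1 |\<union>| \<Phi>\<^sub>2 = \<Delta>\<^sub>1 |\<union>| \<Gamma>\<^sub>2"
    then have prov: "provable ?M (Boxes \<Phi>\<^sub>1 |\<union>| NegDias \<Phi>\<^sub>2 \<Rrightarrow> finsert \<alpha> (Dias \<Psi>\<^sub>1 |\<union>| NegBoxes \<Psi>\<^sub>2))"
      using crosses_mono[OF crosses_modal_context _ fsubset_finsertI]
        crosses_mono[OF crosses_modal_context fsubset_finsertI]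
      by (intro IH[OF that(1)]) simp
    show "provable ?M (Boxes \<Phi>\<^sub>1 |\<union>| NegDias \<Phi>\<^sub>2 \<Rrightarrow> finsert (Box \<alpha>) (Dias \<Psi>\<^sub>1 |\<union>| NegBoxes \<Psi>\<^sub>2)) \<and>
      provable ?M (finsert (Neg (Box \<alpha>)) (Boxes \<Phi>\<^sub>1 |\<union>| NegDias \<Phi>\<^sub>2) \<Rrightarrow> Dias \<Psi>\<^sub>1 |\<union>| NegBoxes \<Psi>\<^sub>2)"
      by (rule conjI[OF provable1[OF rule_instance.intros(15) M(2) prov]
            provable1[OF rule_instance.intros(26) M(4) prov]])
  qed
  have dia: ?case
    if "Ss = [finsert \<alpha> (Boxes \<Gamma>\<^sub>1 |\<union>| NegDias \<Gamma>\<^sub>2) \<Rrightarrow> Dias \<Delta>\<^sub>1 |\<union>| NegBoxes \<Delta>\<^sub>2]"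
      "crosses (Boxes \<Gamma>\<^sub>1 |\<union>| NegDias \<Gamma>\<^sub>2 \<Rrightarrow> Dias \<Delta>\<^sub>1 |\<union>| NegBoxes \<Delta>\<^sub>2) (\<Gamma>' \<Rrightarrow> \<Delta>')"
      "occ (Dia \<alpha>) \<Gamma>' \<Delta>' \<or> occ (Neg (Dia \<alpha>)) \<Delta>' \<Gamma>'" for \<Gamma>\<^sub>1 \<Gamma>\<^sub>2 \<alpha> \<Delta>\<^sub>1 \<Delta>\<^sub>2
    unfolding T
  proof (rule Dia_principal_cross[OF M(1) that(2,3)])
    fix \<Phi>\<^sub>1 \<Phi>\<^sub>2 \<Psi>\<^sub>1 \<Psi>\<^sub>2
    assume "\<Phi>\<^sub>1 |\<union>| \<Psi>\<^sub>2 = \<Gamma>\<^sub>1 |\<union>| \<Delta>\<^sub>2" "\<Psi>\<^sub>1 |\<union>| \<Phi>\<^sub>2 = \<Delta>\<^sub>1 |\<union>| \<Gamma>\<^sub>2"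
    then have prov: "provable ?M (finsert \<alpha> (Boxes \<Phi>\<^sub>1 |\<union>| NegDias \<Phi>\<^sub>2) \<Rrightarrow> Dias \<Psi>\<^sub>1 |\<union>| NegBoxes \<Psi>\<^sub>2)"
      using crosses_mono[OF crosses_modal_context _ fsubset_finsertI]
        crosses_mono[OF crosses_modal_context fsubset_finsertI]
      by (intro IH[OF that(1)]) simp
    show "provable ?M (finsert (Dia \<alpha>) (Boxes \<Phi>\<^sub>1 |\<union>| NegDias \<Phi>\<^sub>2) \<Rrightarrow> Dias \<Psi>\<^sub>1 |\<union>| NegBoxes \<Psi>\<^sub>2) \<and>
      provable ?M (Boxes \<Phi>\<^sub>1 |\<union>| NegDias \<Phi>\<^sub>2 \<Rrightarrow> finsert (Neg (Dia \<alpha>)) (Dias \<Psi>\<^sub>1 |\<union>| NegBoxes \<Psi>\<^sub>2))"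
      by (rule conjI[OF provable1[OF rule_instance.intros(16) M(3) prov]
            provable1[OF rule_instance.intros(29) M(5) prov]])
  qed
  show ?case
  proof (cases "r \<in> common")
    case True
    then show ?thesis
      using provable_cross_common[OF M(1) 1(2)] 1 T by blast
  next
    case False
    with 1(1) have "r \<in> {BoxRight, DiaLeft, NegBoxLeft, NegDiaRight}"
      by (simp add: cut_free_lTS4)
    with 1(2) show ?thesis
    proof cases
      case 15
      show ?thesis
        by (rule box[OF 15(2)]) (use 1(4) 15(3) T in simp_all)
    next
      case 16
      show ?thesis
        by (rule dia[OF 16(2)]) (use 1(4) 16(3) T in simp_all)
    next
      case 26
      show ?thesis
        by (rule box[OF 26(2)]) (use 1(4) 26(3) T in simp_all)
    next
      case 29
      show ?thesis
        by (rule dia[OF 29(2)]) (use 1(4) 29(3) T in simp_all)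
    qed simp_all
  qed
qed

text \<open>The premise of a modal rule with superscript T depends on its context only through the
  union of the boxed bodies and the union of the diamond bodies. Rearranging the context preserves
  both, so the given premise serves unchanged.\<close>

lemma provable_cross_gTS4:
  assumes "provable (cut_free gTS4) S" "crosses S T"
  shows "provable (cut_free gTS4) T"
  using assms
proof (induction arbitrary: T)
  case (1 r Ss S)
  let ?M = "cut_free gTS4"
  obtain \<Gamma>' \<Delta>' where T: "T = (\<Gamma>' \<Rrightarrow> \<Delta>')"
    by (cases T)
  have M: "common \<subseteq> ?M" "BoxRightT \<in> ?M" "DiaLeftT \<in> ?M" "NegBoxLeftT \<in> ?M" "NegDiaRightT \<in> ?M"
    by (auto simp: cut_free_gTS4)
  have prem: "provable ?M S'" if "Ss = [S']" for S'
    using 1 that by auto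
  have box: ?case
    if "Ss = [Boxes \<Gamma>\<^sub>1 |\<union>| Boxes \<Delta>\<^sub>2 \<Rrightarrow> finsert \<alpha> (Dias \<Delta>\<^sub>1 |\<union>| Dias \<Gamma>\<^sub>2)]"
      "crosses (Boxes \<Gamma>\<^sub>1 |\<union>| NegDias \<Gamma>\<^sub>2 \<Rrightarrow> Dias \<Delta>\<^sub>1 |\<union>| NegBoxes \<Delta>\<^sub>2) (\<Gamma>' \<Rrightarrow> \<Delta>')"
      "occ (Box \<alpha>) \<Delta>' \<Gamma>' \<or> occ (Neg (Box \<alpha>)) \<Gamma>' \<Delta>'" for \<Gamma>\<^sub>1 \<Gamma>\<^sub>2 \<alpha> \<Delta>\<^sub>1 \<Delta>\<^sub>2
    unfolding T
  proof (rule Box_principal_cross[OF M(1) that(2,3)])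
    fix \<Phi>\<^sub>1 \<Phi>\<^sub>2 \<Psi>\<^sub>1 \<Psi>\<^sub>2
    assume "\<Phi>\<^sub>1 |\<union>| \<Psi>\<^sub>2 = \<Gamma>\<^sub>1 |\<union>| \<Delta>\<^sub>2" "\<Psi>\<^sub>1 |\<union>| \<Phi>\<^sub>2 = \<Delta>\<^sub>1 |\<union>| \<Gamma>\<^sub>2"
    then have prov: "provable ?M (Boxes \<Phi>\<^sub>1 |\<union>| Boxes \<Psi>\<^sub>2 \<Rrightarrow> finsert \<alpha> (Dias \<Psi>\<^sub>1 |\<union>| Dias \<Phi>\<^sub>2))"
      \<comment> \<open>Read as images of unions, this sequent is the old premise.\<close>
      using prem[OF that(1)] by (simp only: fimage_funion[symmetric])
    show "provable ?M (Boxes \<Phi>\<^sub>1 |\<union>| NegDias \<Phi>\<^sub>2 \<Rrightarrow> finsert (Box \<alpha>) (Dias \<Psi>\<^sub>1 |\<union>| NegBoxes \<Psi>\<^sub>2)) \<and>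
      provable ?M (finsert (Neg (Box \<alpha>)) (Boxes \<Phi>\<^sub>1 |\<union>| NegDias \<Phi>\<^sub>2) \<Rrightarrow> Dias \<Psi>\<^sub>1 |\<union>| NegBoxes \<Psi>\<^sub>2)"
      by (rule conjI[OF provable1[OF rule_instance.intros(30) M(2) prov]
            provable1[OF rule_instance.intros(32) M(4) prov]])
  qed
  have dia: ?case
    if "Ss = [finsert \<alpha> (Boxes \<Gamma>\<^sub>1 |\<union>| Boxes \<Delta>\<^sub>2) \<Rrightarrow> Dias \<Delta>\<^sub>1 |\<union>| Dias \<Gamma>\<^sub>2]"
      "crosses (Boxes \<Gamma>\<^sub>1 |\<union>| NegDias \<Gamma>\<^sub>2 \<Rrightarrow> Dias \<Delta>\<^sub>1 |\<union>| NegBoxes \<Delta>\<^sub>2) (\<Gamma>' \<Rrightarrow> \<Delta>')"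
      "occ (Dia \<alpha>) \<Gamma>' \<Delta>' \<or> occ (Neg (Dia \<alpha>)) \<Delta>' \<Gamma>'" for \<Gamma>\<^sub>1 \<Gamma>\<^sub>2 \<alpha> \<Delta>\<^sub>1 \<Delta>\<^sub>2
    unfolding T
  proof (rule Dia_principal_cross[OF M(1) that(2,3)])
    fix \<Phi>\<^sub>1 \<Phi>\<^sub>2 \<Psi>\<^sub>1 \<Psi>\<^sub>2
    assume "\<Phi>\<^sub>1 |\<union>| \<Psi>\<^sub>2 = \<Gamma>\<^sub>1 |\<union>| \<Delta>\<^sub>2" "\<Psi>\<^sub>1 |\<union>| \<Phi>\<^sub>2 = \<Delta>\<^sub>1 |\<union>| \<Gamma>\<^sub>2"
    then have prov: "provable ?M (finsert \<alpha> (Boxes \<Phi>\<^sub>1 |\<union>| Boxes \<Psi>\<^sub>2) \<Rrightarrow> Dias \<Psi>\<^sub>1 |\<union>| Dias \<Phi>\<^sub>2)"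
      using prem[OF that(1)] by (simp only: fimage_funion[symmetric])
    show "provable ?M (finsert (Dia \<alpha>) (Boxes \<Phi>\<^sub>1 |\<union>| NegDias \<Phi>\<^sub>2) \<Rrightarrow> Dias \<Psi>\<^sub>1 |\<union>| NegBoxes \<Psi>\<^sub>2) \<and>
      provable ?M (Boxes \<Phi>\<^sub>1 |\<union>| NegDias \<Phi>\<^sub>2 \<Rrightarrow> finsert (Neg (Dia \<alpha>)) (Dias \<Psi>\<^sub>1 |\<union>| NegBoxes \<Psi>\<^sub>2))"
      by (rule conjI[OF provable1[OF rule_instance.intros(31) M(3) prov]
            provable1[OF rule_instance.intros(33) M(5) prov]])
  qed
  show ?case
  proof (cases "r \<in> common")
    case True
    then show ?thesis
      using provable_cross_common[OF M(1) 1(2)] 1 T by blast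
  next
    case False
    with 1(1) have "r \<in> {BoxRightT, DiaLeftT, NegBoxLeftT, NegDiaRightT}"
      by (simp add: cut_free_gTS4)
    with 1(2) show ?thesis
    proof cases
      case 30
      show ?thesis
        by (rule box[OF 30(2)]) (use 1(4) 30(3) T in simp_all)
    next
      case 31
      show ?thesis
        by (rule dia[OF 31(2)]) (use 1(4) 31(3) T in simp_all)
    next
      case 32
      show ?thesis
        by (rule box[OF 32(2)]) (use 1(4) 32(3) T in simp_all)
    next
      case 33
      show ?thesis
        by (rule dia[OF 33(2)]) (use 1(4) 33(3) T in simp_all)
    qed simp_all
  qed
qed

theorem theorem4p1:
  fixes L :: "rule set"
  assumes "L = lTS4 \<or> L = gTS4"
  shows "admissible NegLeft (cut_free L) \<and> admissible NegRight (cut_free L)"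
proof -
  have cross: "provable (cut_free L) T" if "provable (cut_free L) S" "crosses S T" for S T
    using assms that provable_cross_lTS4[of S T] provable_cross_gTS4[of S T] by blast
  have "admissible r (cut_free L)" if r: "r = NegLeft \<or> r = NegRight" for r
    unfolding admissible_def
  proof (intro allI impI)
    fix Ss S
    assume inst: "rule_instance r Ss S" and prems: "\<forall>S' \<in> set Ss. provable (cut_free L) S'"
    \<comment> \<open>The premise of either negation rule crosses to its conclusion: the active
      formula is found negated on the opposite side, and the context stays in place.\<close>
    obtain S' where "Ss = [S']" "crosses S' S"
      using inst
    proof cases
      case 34
      then show thesis
        using that(1) by (simp add: crosses.simps occ_def)
    next
      case 35
      then show thesis
        using that(1) by (simp add: crosses.simps occ_def)
    qed (use r in simp_all)
    then show "provable (cut_free L) S"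
      using prems cross[of S' S] by simp
  qed
  then show ?thesis
    by simp
qed

end
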